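(* Let $C$ be an $n$-by-$m$ quaternion matrix, $n\ge m$, and let $C^*$ be the dual of $C$. Then $$\mathrm{Det}_M\left(C^*C\right)=\sum_I\mathrm{Det}_M\left((C^I)^*C^I\right),$$ where the summation is over $I=(i_1<i_2<\ldots<i_m)$, the ordered subsets of $\{1,\ldots,n\}$ that consist of $m$ elements, and where $C^I$ consists of rows $i_1,\ldots,i_m$ of $C$.
   Context: Quaternion matrices have entries in the complexified quaternions $\mathbb{Q}_{\mathbb{C}}$: $q=s+x\mathbf{i}+y\mathbf{j}+z\mathbf{k}$ with $s,x,y,z\in\mathbb{C}$ (usual quaternion multiplication rules, complex scalars central), with conjugate $q^*=s-x\mathbf{i}-y\mathbf{j}-z\mathbf{k}$ (the coefficients are not complex-conjugated). The dual $X^*$ of a quaternion matrix $X$ is defined by $(X^* )_{lk}=(X_{kl})^*$. Moore-Dyson determinant. For an $n\times n$ quaternion matrix $X$, write each permutation $\sigma\in S_n$ as a product of cycles $\sigma=(n_1i_2\ldots i_s)(n_2j_2\ldots j_t)\ldots(n_rk_2\ldots k_l)$ where $n_i$ is the largest element of its cycle and $n_1>n_2>\ldots>n_r$. Then $\mathrm{Det}_M(X)=\sum_{\sigma}\varepsilon(\sigma)\left(X_{n_1i_2}X_{i_2i_3}\ldots X_{i_sn_1}\right)\ldots\left(X_{n_rk_2}X_{k_2k_3}\ldots X_{k_ln_r}\right)$, where $\varepsilon(\sigma)=(-1)^{n-r}$ is the sign of $\sigma$. It is scalar for every self-dual $X$ (i.e. $X^*=X$). *)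

theory Defs
  imports "Jordan_Normal_Form.DL_Submatrix" "HOL-Combinatorics.Orbits" Complex_Main
begin

section \<open>Complexified quaternions\<close>

text \<open>\<open>CQ s x y z\<close> stands for $s + x\mathbf{i} + y\mathbf{j} + z\mathbf{k}$ with complex coefficients;
  the quaternion units commute with the imaginary unit of the coefficient field.\<close>

datatype cquat = CQ (cq_s: complex) (cq_x: complex) (cq_y: complex) (cq_z: complex)

instantiation cquat :: ring_1
begin

definition "0 = CQ 0 0 0 0"
definition "1 = CQ 1 0 0 0"
definition "- p = CQ (- cq_s p) (- cq_x p) (- cq_y p) (- cq_z p)"
definition "p + q = CQ (cq_s p + cq_s q) (cq_x p + cq_x q) (cq_y p + cq_y q) (cq_z p + cq_z q)"
definition "p - q = CQ (cq_s p - cq_s q) (cq_x p - cq_x q) (cq_y p - cq_y q) (cq_z p - cq_z q)"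
definition "p * q =
  CQ (cq_s p * cq_s q - cq_x p * cq_x q - cq_y p * cq_y q - cq_z p * cq_z q)
     (cq_s p * cq_x q + cq_x p * cq_s q + cq_y p * cq_z q - cq_z p * cq_y q)
     (cq_s p * cq_y q - cq_x p * cq_z q + cq_y p * cq_s q + cq_z p * cq_x q)
     (cq_s p * cq_z q + cq_x p * cq_y q - cq_y p * cq_x q + cq_z p * cq_s q)"

instance
  by standard
    (simp_all add: zero_cquat_def one_cquat_def uminus_cquat_def plus_cquat_def
      minus_cquat_def times_cquat_def algebra_simps)

end

lemma cquat_unit_rules:
  defines "i \<equiv> CQ 0 1 0 0" and "j \<equiv> CQ 0 0 1 0" and "k \<equiv> CQ 0 0 0 1"
  shows "i * i = - 1" "j * j = - 1" "k * k = - 1"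
    "i * j = k" "j * k = i" "k * i = j" "j * i = - k" "k * j = - i" "i * k = - j"
  by (simp_all add: i_def j_def k_def times_cquat_def one_cquat_def uminus_cquat_def)

lemma cquat_scalar_central: "CQ c 0 0 0 * q = q * CQ c 0 0 0"
  by (simp add: times_cquat_def mult.commute)

lemma cquat_decomp:
  "CQ s x y z = CQ s 0 0 0 + CQ x 0 0 0 * CQ 0 1 0 0 + CQ y 0 0 0 * CQ 0 0 1 0
    + CQ z 0 0 0 * CQ 0 0 0 1"
  by (simp add: times_cquat_def plus_cquat_def)

text \<open>The coefficients are not complex-conjugated.\<close>

definition cq_conj :: "cquat \<Rightarrow> cquat" where
  "cq_conj q = CQ (cq_s q) (- cq_x q) (- cq_y q) (- cq_z q)"

definition dual_mat :: "cquat mat \<Rightarrow> cquat mat" where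
  "dual_mat X = mat (dim_col X) (dim_row X) (\<lambda>(l, k). cq_conj (X $$ (k, l)))"


section \<open>The Moore-Dyson determinant\<close>

text \<open>The cycle $(a\, i_2 \ldots i_s)$ of a permutation \<open>p\<close> is read as $i_{t+1} = p(i_t)$ with
  $i_1 = a$, so \<open>cycle_prod\<close> is $X_{a i_2} X_{i_2 i_3} \ldots X_{i_s a}$
  (just $X_{aa}$ at a fixed point, where \<open>orbit p a = {a}\<close>).\<close>

definition cycle_prod :: "cquat mat \<Rightarrow> (nat \<Rightarrow> nat) \<Rightarrow> nat \<Rightarrow> cquat" where
  "cycle_prod X p a =
    prod_list (map (\<lambda>t. X $$ ((p ^^ t) a, (p ^^ Suc t) a)) [0..<card (orbit p a)])"

text \<open>The largest elements $n_1, \ldots, n_r$ of the cycles, fixed points included.\<close>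

definition cycle_maxima :: "nat \<Rightarrow> (nat \<Rightarrow> nat) \<Rightarrow> nat set" where
  "cycle_maxima n p = {a \<in> {0..<n}. \<forall>b \<in> orbit p a. b \<le> a}"

text \<open>The cycle products are noncommutative and are multiplied in the order
  $n_1 > n_2 > \ldots > n_r$.  Indices run over \<open>{0..<n}\<close>.\<close>

definition Det_M :: "cquat mat \<Rightarrow> cquat" where
  "Det_M X = (\<Sum>p | p permutes {0..<dim_row X}.
     of_int (sign p) *
     prod_list (map (cycle_prod X p) (rev (sorted_list_of_set (cycle_maxima (dim_row X) p)))))"

end

theory Submission
  imports Defs "HOL-Combinatorics.Cycles" "Jordan_Normal_Form.Determinant"
begin

text \<open>
  For a set \<open>J\<close> of rows let \<open>g J\<close> be the determinant of the Gram matrix of the rows of \<open>C\<close> in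
  \<open>J\<close>. Each summand of the determinant is a product of \<open>m\<close> entries, and each entry is additive
  in \<open>J\<close>, so \<open>g J\<close> is a sum \<open>\<Sum>h K\<close> over the subsets \<open>K\<close> of \<open>J\<close> with at most \<open>m\<close>
  elements. If \<open>g\<close> vanishes on sets with fewer than \<open>m\<close> elements, then so does \<open>h\<close>, and \<open>h\<close> and
  \<open>g\<close> agree on sets with \<open>m\<close> elements, which is the claim.

  The vanishing is a rank argument. For self-dual \<open>X\<close>, summing a cycle together with its reversal
  replaces every cycle product by its scalar part, so the determinant is a scalar that can be
  expanded along the cycle through any index. This yields Cramer's rule: there is \<open>Y\<close> with
  \<open>X Y = d I\<close>, where \<open>d\<close> is the determinant of \<open>X\<close>. If \<open>X\<close> is the Gram matrix of \<open>k < m\<close> rows,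
  then \<open>d I\<close> factors through a space of dimension \<open>2 k < 2 m\<close> over the complex numbers
  (quaternions being complex \<open>2 \<times> 2\<close> matrices), whence \<open>d = 0\<close>.
\<close>

section \<open>Expansion of the determinant along a cycle\<close>

text \<open>A permutation is determined by the cycle \<open>a # l\<close> through a chosen \<open>a\<close> together with a
  permutation of the complement, so sums over permutations become sums over repetition-free
  lists \<open>l\<close>.\<close>

definition dlists :: "'a set \<Rightarrow> 'a list set" where
  "dlists S = {l. distinct l \<and> set l \<subseteq> S}"

text \<open>A cycle of a permutation becomes the closed walk \<open>a # l @ [a]\<close>; for
  \<open>l = []\<close> this is the single diagonal entry of a fixed point.\<close>

fun walk :: "('a \<Rightarrow> 'a \<Rightarrow> 'b::ring_1) \<Rightarrow> 'a list \<Rightarrow> 'b" where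
  "walk x (a # b # l) = x a b * walk x (b # l)"
| "walk x l = 1"

definition orbit_walk :: "('a \<Rightarrow> 'a \<Rightarrow> 'b::ring_1) \<Rightarrow> ('a \<Rightarrow> 'a) \<Rightarrow> 'a \<Rightarrow> 'b" where
  "orbit_walk x p a = prod_list (map (\<lambda>t. x ((p ^^ t) a) ((p ^^ Suc t) a)) [0..<card (orbit p a)])"

text \<open>Arbitrary index sets are allowed so that removing a cycle leaves a determinant of the
  same kind, without renumbering.\<close>

definition det_on :: "('a::linorder \<Rightarrow> 'a \<Rightarrow> 'b::ring_1) \<Rightarrow> 'a set \<Rightarrow> 'b" where
  "det_on x S = (\<Sum>p | p permutes S. of_int (sign p) *
     prod_list (map (orbit_walk x p) (rev (sorted_list_of_set {a \<in> S. \<forall>b \<in> orbit p a. b \<le> a}))))"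

lemma Det_M_eq_det_on: "Det_M X = det_on (\<lambda>i j. X $$ (i, j)) {0..<dim_row X}"
  by (simp add: Det_M_def det_on_def cycle_maxima_def cycle_prod_def[abs_def] orbit_walk_def[abs_def])

lemma finite_dlists [simp]: "finite S \<Longrightarrow> finite (dlists S)"
  unfolding dlists_def using finite_subset_distinct[of S] by (simp add: conj_commute)

lemma walk_conv_prod_list:
  "walk x w = prod_list (map (\<lambda>t. x (w ! t) (w ! Suc t)) [0..<length w - 1])"
proof (induction x w rule: walk.induct)
  case (1 x a b l)
  have "[0..<length (a # b # l) - 1] = 0 # map Suc [0..<length (b # l) - 1]"
    by (simp add: map_Suc_upt upt_conv_Cons del: upt_Suc)
  with 1 show ?case by (simp add: o_def)
qed auto

lemma sign_cycle_of_list: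
  "distinct cs \<Longrightarrow> sign (cycle_of_list cs) = (- 1) ^ (length cs - 1)"
proof (induction cs rule: cycle_of_list.induct)
  case (1 i j cs)
  then show ?case
    by (simp add: sign_compose permutation_swap_id permutation_of_cycle sign_swap_id
        del: o_apply)
qed auto

section \<open>Permutations with a prescribed cycle through \<open>a\<close>\<close>

context
  fixes a :: 'a and l :: "'a list" and S :: "'a set" and p q c :: "'a \<Rightarrow> 'a"
  assumes S: "finite S" "a \<in> S" and l: "l \<in> dlists (S - {a})"
    and q: "q permutes (S - {a} - set l)"
  defines "c \<equiv> cycle_of_list (a # l)"
  defines "p \<equiv> c \<circ> q"
begin

lemma peel_distinct: "distinct (a # l)"
  using l by (auto simp: dlists_def)

lemma peel_permutes: "p permutes S"
proof -
  have "c permutes S"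
    using cycle_permutes[of "a # l"] l S unfolding c_def
    by (auto simp: dlists_def intro: permutes_subset)
  moreover have "q permutes S"
    using q by (rule permutes_subset) auto
  ultimately show ?thesis
    unfolding p_def by (rule permutes_compose[rotated])
qed

lemma peel_apply_in: "b \<in> set (a # l) \<Longrightarrow> p b = c b"
  using permutes_not_in[OF q, of b] by (auto simp: p_def)

lemma peel_apply_out: "b \<in> S - {a} - set l \<Longrightarrow> p b = q b"
  using permutes_in_image[OF q, of b] id_outside_supp[of "q b" "a # l"] by (auto simp: p_def c_def)

lemma peel_funpow_nth: "(p ^^ t) a = (a # l) ! (t mod length (a # l))"
proof -
  \<comment> \<open>Applying \<open>c\<close> to its own list rotates it, and \<open>p\<close>
    agrees with \<open>c\<close> on that list, so the iterates of \<open>p\<close> at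
    \<open>a\<close> run through it cyclically.\<close>
  have cs: "map (c ^^ t) (a # l) = rotate t (a # l)" for t
    unfolding c_def by (rule cyclic_rotation[OF peel_distinct])
  have nth: "(c ^^ t) a = (a # l) ! (t mod length (a # l))" for t
  proof -
    have "(c ^^ t) a = map (c ^^ t) (a # l) ! 0"
      by simp
    also have "\<dots> = (a # l) ! (t mod length (a # l))"
      unfolding cs by (subst nth_rotate) auto
    finally show ?thesis .
  qed
  have "(p ^^ t) a = (c ^^ t) a"
  proof (induction t)
    case (Suc t)
    have "(c ^^ t) a \<in> set (a # l)"
      unfolding nth by (rule nth_mem) simp
    with Suc show ?case
      using peel_apply_in by simp
  qed simp
  with nth show ?thesis by simp
qed

lemma peel_orbit: "orbit p a = set (a # l)"
proof -
  have "orbit p a = {(p ^^ t) a |t. t < length (a # l)}"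
    by (rule orbit_altdef_bounded) (use peel_funpow_nth[of "length (a # l)"] in auto)
  also have "\<dots> = {(a # l) ! t |t. t < length (a # l)}"
  proof -
    have "(p ^^ t) a = (a # l) ! t" if "t < length (a # l)" for t
      unfolding peel_funpow_nth using that by simp
    then show ?thesis
      by (intro Collect_cong) metis
  qed
  finally show ?thesis
    by (simp add: set_conv_nth)
qed

text \<open>Reads the cycle back off \<open>p\<close> alone, which gives the injectivity in
  \<open>peel_bij\<close>.\<close>

lemma peel_list: "a # l = map (\<lambda>t. (p ^^ t) a) [0..<card (orbit p a)]"
proof (rule nth_equalityI)
  have "card (orbit p a) = length (a # l)"
    unfolding peel_orbit using peel_distinct by (rule distinct_card)
  then show "length (a # l) = length (map (\<lambda>t. (p ^^ t) a) [0..<card (orbit p a)])"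
    by simp
  fix t assume "t < length (a # l)"
  with \<open>card (orbit p a) = length (a # l)\<close> show "(a # l) ! t = map (\<lambda>t. (p ^^ t) a) [0..<card (orbit p a)] ! t"
    using peel_funpow_nth[of t] by (simp del: upt_Suc)
qed

lemma peel_orbit_walk: "orbit_walk x p a = walk x (a # l @ [a])"
proof -
  have card: "card (orbit p a) = length (a # l)"
    unfolding peel_orbit using peel_distinct by (rule distinct_card)
  have *: "(a # l @ [a]) ! t = (p ^^ t) a" if "t \<le> length (a # l)" for t
  proof (cases "t = length (a # l)")
    case True
    then show ?thesis
      unfolding peel_funpow_nth by (simp add: nth_append)
  next
    case False
    with that have t: "t < length (a # l)" by simp
    have "(a # l @ [a]) ! t = ((a # l) @ [a]) ! t"
      by simp
    also have "\<dots> = (a # l) ! t"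
      using t by (simp only: nth_append if_True)
    finally show ?thesis
      unfolding peel_funpow_nth using t by simp
  qed
  show ?thesis
    unfolding walk_conv_prod_list orbit_walk_def card
  proof (intro arg_cong[of _ _ prod_list] map_cong)
    fix t assume "t \<in> set [0..<length (a # l @ [a]) - 1]"
    then have "t \<le> length (a # l)" "Suc t \<le> length (a # l)"
      by auto
    then show "x ((p ^^ t) a) ((p ^^ Suc t) a) = x ((a # l @ [a]) ! t) ((a # l @ [a]) ! Suc t)"
      by (simp only: *)
  qed simp
qed

lemma peel_funpow_out:
  assumes b: "b \<in> S - {a} - set l"
  shows "(p ^^ t) b = (q ^^ t) b"
proof (induction t)
  case (Suc t)
  have "(q ^^ t) b \<in> S - {a} - set l"
    using b permutes_in_image[OF permutes_funpow[OF q]] by blast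
  from peel_apply_out[OF this] Suc show ?case
    by (simp only: funpow.simps o_apply)
qed simp

lemma peel_orbit_out: "b \<in> S - {a} - set l \<Longrightarrow> orbit p b = orbit q b"
  by (simp only: orbit_altdef peel_funpow_out)

lemma peel_orbit_walk_out: "b \<in> S - {a} - set l \<Longrightarrow> orbit_walk x p b = orbit_walk x q b"
  by (simp only: orbit_walk_def peel_orbit_out peel_funpow_out)

lemma peel_sign: "sign p = (- 1) ^ length l * sign q"
proof -
  have "permutation q"
    using q S(1) unfolding permutation_permutes by (meson finite_Diff)
  then have "sign p = sign c * sign q"
    unfolding p_def c_def by (intro sign_compose permutation_of_cycle)
  then show ?thesis
    unfolding c_def using sign_cycle_of_list[OF peel_distinct] by simp
qed

end

text \<open>For surjectivity, the cycle is the \<open>support\<close> of \<open>p\<close> at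
  \<open>a\<close>; composing \<open>p\<close> with the inverse of this cycle leaves a permutation
  that fixes every element of the cycle.\<close>

lemma peel_bij:
  assumes S: "finite S" "a \<in> S"
  shows "bij_betw (\<lambda>(l, q). cycle_of_list (a # l) \<circ> q)
    (SIGMA l : dlists (S - {a}). {q. q permutes (S - {a} - set l)}) {p. p permutes S}"
  unfolding bij_betw_def
proof
  show "inj_on (\<lambda>(l, q). cycle_of_list (a # l) \<circ> q)
    (SIGMA l : dlists (S - {a}). {q. q permutes (S - {a} - set l)})"
  proof (rule inj_onI, clarify)
    fix l l' q q'
    assume l: "l \<in> dlists (S - {a})" "q permutes (S - {a} - set l)"
      and l': "l' \<in> dlists (S - {a})" "q' permutes (S - {a} - set l')"
      and eq: "cycle_of_list (a # l) \<circ> q = cycle_of_list (a # l') \<circ> q'"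
    have "a # l = a # l'"
      by (rule trans[OF peel_list[OF S l] sym[OF peel_list[OF S l'], folded eq]])
    then have "l = l'"
      by simp
    moreover have "inj (cycle_of_list (a # l))"
      using cycle_permutes by (rule permutes_inj)
    ultimately show "l = l' \<and> q = q'"
      using eq by (auto simp: fun_eq_iff inj_eq)
  qed
next
  have *: "\<exists>l q. l \<in> dlists (S - {a}) \<and> q permutes (S - {a} - set l) \<and> p = cycle_of_list (a # l) \<circ> q"
    if p: "p permutes S" for p
  proof -
    have perm: "permutation p"
      using p S(1) by (auto simp: permutation_permutes)
    define cs where "cs = support p a"
    define l where "l = tl cs"
    have "least_power p a > 0"
      by (rule least_power_of_permutation[OF perm])
    then have cs: "cs = a # l"
      unfolding cs_def l_def by (simp add: upt_conv_Cons)
    have "distinct cs"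
      unfolding cs_def by (rule cycle_of_permutation[OF perm])
    have "(p ^^ i) a \<in> S" for i
      using permutes_in_image[OF permutes_funpow[OF p]] S by simp
    then have sub: "set cs \<subseteq> S"
      unfolding cs_def by auto
    have l: "l \<in> dlists (S - {a})"
      using \<open>distinct cs\<close> sub unfolding cs by (auto simp: dlists_def)
    define c where "c = cycle_of_list cs"
    have "c permutes set cs"
      unfolding c_def by (rule cycle_permutes)
    then have "c permutes S"
      using sub by (rule permutes_subset)
    define q where "q = inv_into UNIV c \<circ> p"
    have "q permutes S"
      unfolding q_def using p permutes_inv[OF \<open>c permutes S\<close>] by (rule permutes_compose)
    moreover have "q b = b" if "b \<in> set cs" for b
      using cycle_restrict[OF perm, of b a] that
      unfolding q_def cs_def c_def by (simp add: permutes_inverses[OF cycle_permutes])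
    ultimately have "q permutes (S - {a} - set l)"
      using permutes_superset[of q S "S - {a} - set l"] by (auto simp: cs)
    moreover have "p = c \<circ> q"
      unfolding q_def by (simp add: fun_eq_iff permutes_inverses[OF \<open>c permutes S\<close>])
    ultimately show ?thesis
      using l unfolding c_def cs by blast
  qed
  show "(\<lambda>(l, q). cycle_of_list (a # l) \<circ> q) `
    (SIGMA l : dlists (S - {a}). {q. q permutes (S - {a} - set l)}) = {p. p permutes S}"
  proof (intro equalityI subsetI)
    fix p assume "p \<in> (\<lambda>(l, q). cycle_of_list (a # l) \<circ> q) `
      (SIGMA l : dlists (S - {a}). {q. q permutes (S - {a} - set l)})"
    then obtain l q where "l \<in> dlists (S - {a})" "q permutes (S - {a} - set l)"
      "p = cycle_of_list (a # l) \<circ> q"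
      by auto
    then show "p \<in> {p. p permutes S}"
      using peel_permutes[OF S] by simp
  next
    fix p assume "p \<in> {p. p permutes S}"
    then obtain l q where "l \<in> dlists (S - {a})" "q permutes (S - {a} - set l)"
      "p = cycle_of_list (a # l) \<circ> q"
      using * by blast
    then show "p \<in> (\<lambda>(l, q). cycle_of_list (a # l) \<circ> q) `
      (SIGMA l : dlists (S - {a}). {q. q permutes (S - {a} - set l)})"
      by (intro image_eqI[of _ _ "(l, q)"]) simp_all
  qed
qed

lemma det_on_empty [simp]: "det_on x {} = 1"
  by (simp add: det_on_def)

text \<open>The cycle through the maximum supplies the leftmost factor of every summand, so it
  splits off on the left without commuting any entries; only signs are moved. This is the recursion
  behind the later inductions.\<close>

lemma det_on_Max:
  assumes S: "finite S" "S \<noteq> {}"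
  defines "a \<equiv> Max S"
  shows "det_on x S = (\<Sum>l \<in> dlists (S - {a}). (- 1) ^ length l * walk x (a # l @ [a])
           * det_on x (S - {a} - set l))"
proof -
  have aS: "a \<in> S" "\<And>b. b \<in> S \<Longrightarrow> b \<le> a"
    using S by (auto simp: a_def)
  define w where "w S p = of_int (sign p) *
     prod_list (map (orbit_walk x p) (rev (sorted_list_of_set {a \<in> S. \<forall>b \<in> orbit p a. b \<le> a})))"
    for S p
  have w: "w S (cycle_of_list (a # l) \<circ> q) = (- 1) ^ length l * walk x (a # l @ [a]) * w (S - {a} - set l) q"
    if l: "l \<in> dlists (S - {a})" and q: "q permutes (S - {a} - set l)" for l q
  proof -
    note P = peel_orbit[OF S(1) aS(1) l q] peel_orbit_walk[OF S(1) aS(1) l q]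
      peel_orbit_out[OF S(1) aS(1) l q] peel_orbit_walk_out[OF S(1) aS(1) l q]
      peel_sign[OF S(1) aS(1) l q]
    define p where "p = cycle_of_list (a # l) \<circ> q"
    note P = P[folded p_def]
    define M where "M = {b \<in> S - {a} - set l. \<forall>d \<in> orbit q b. d \<le> b}"
    have perm: "permutation p"
      unfolding permutation_permutes p_def using S(1) peel_permutes[OF S(1) aS(1) l q]
      by (intro exI[of _ S] conjI)
    have l_less: "b < a" if "b \<in> set l" for b
    proof -
      from l that have "b \<in> S" "b \<noteq> a"
        unfolding dlists_def by auto
      with aS(2) show ?thesis
        by (simp add: less_le)
    qed
    have orb: "a \<in> orbit p b" if "b \<in> set l" for b
    proof -
      have "b \<in> orbit p a"
        unfolding P(1) using that by simp
      then show ?thesis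
        by (rule orbit_swap[OF permutation_self_in_orbit[OF perm, of a]])
    qed
    \<comment> \<open>Elements of \<open>l\<close> share their cycle with the larger
      \<open>a\<close>, so they are not cycle maxima; off the cycle, \<open>p\<close> and
      \<open>q\<close> have the same orbits.\<close>
    have "{b \<in> S. \<forall>d \<in> orbit p b. d \<le> b} = insert a M" (is "?L = _")
    proof
      show "{b \<in> S. \<forall>d \<in> orbit p b. d \<le> b} \<subseteq> insert a M"
      proof
        fix b assume b: "b \<in> {b \<in> S. \<forall>d \<in> orbit p b. d \<le> b}"
        have "b \<notin> set l"
        proof
          assume "b \<in> set l"
          with b orb have "a \<le> b" by blast
          with l_less[OF \<open>b \<in> set l\<close>] show False by simp
        qed
        with b show "b \<in> insert a M"
          using P(3)[of b] by (auto simp: M_def)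
      qed
      show "insert a M \<subseteq> ?L"
        using aS P(1) P(3) l by (auto simp: M_def dlists_def)
    qed
    moreover have "sorted_list_of_set (insert a M) = sorted_list_of_set M @ [a]"
    proof -
      have "finite M" "a \<notin> M" "\<And>b. b \<in> M \<Longrightarrow> b < a"
        using S(1) aS(2) by (auto simp: M_def less_le)
      then show ?thesis
        by (simp add: sorted_insort_is_snoc less_imp_le)
    qed
    moreover have "map (orbit_walk x p) (rev (sorted_list_of_set M))
        = map (orbit_walk x q) (rev (sorted_list_of_set M))"
      using S(1) P(4) by (intro map_cong) (auto simp: M_def)
    ultimately have list: "map (orbit_walk x p) (rev (sorted_list_of_set {b \<in> S. \<forall>d \<in> orbit p b. d \<le> b}))
        = walk x (a # l @ [a]) # map (orbit_walk x q) (rev (sorted_list_of_set M))"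
      by (simp add: P(2))
    have sign: "of_int (sign p) * (walk x (a # l @ [a]) * d)
        = (- 1) ^ length l * walk x (a # l @ [a]) * (of_int (sign q) * d)" for d
    proof -
      have "of_int (sign q) * (walk x (a # l @ [a]) * d) = walk x (a # l @ [a]) * (of_int (sign q) * d)"
        by (metis mult.assoc mult_of_int_commute)
      then show ?thesis
        by (simp add: P(5) mult.assoc)
    qed
    show ?thesis
      unfolding w_def p_def[symmetric] M_def[symmetric] list prod_list.Cons sign ..
  qed
  have "det_on x S = sum (w S) {p. p permutes S}"
    by (simp add: det_on_def w_def)
  also have "\<dots> = (\<Sum>(l, q) \<in> (SIGMA l : dlists (S - {a}). {q. q permutes (S - {a} - set l)}).
      w S (cycle_of_list (a # l) \<circ> q))"
    by (subst sum.reindex_bij_betw[OF peel_bij[OF S(1) aS(1)], symmetric]) (simp add: case_prod_unfold)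
  also have "\<dots> = (\<Sum>(l, q) \<in> (SIGMA l : dlists (S - {a}). {q. q permutes (S - {a} - set l)}).
      (- 1) ^ length l * walk x (a # l @ [a]) * w (S - {a} - set l) q)"
    by (intro sum.cong) (auto simp: w)
  also have "\<dots> = (\<Sum>l \<in> dlists (S - {a}). \<Sum>q | q permutes (S - {a} - set l).
      (- 1) ^ length l * walk x (a # l @ [a]) * w (S - {a} - set l) q)"
    using S(1) by (subst sum.Sigma) (auto simp: finite_permutations)
  also have "\<dots> = (\<Sum>l \<in> dlists (S - {a}). (- 1) ^ length l * walk x (a # l @ [a])
           * det_on x (S - {a} - set l))"
    by (simp add: sum_distrib_left det_on_def w_def)
  finally show ?thesis .
qed


section \<open>Scalars\<close>

lemma cq_add_simps [simp]:
  "cq_s (p + q) = cq_s p + cq_s q" "cq_x (p + q) = cq_x p + cq_x q"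
  "cq_y (p + q) = cq_y p + cq_y q" "cq_z (p + q) = cq_z p + cq_z q"
  by (simp_all add: plus_cquat_def)

lemma cq_zero_one_simps [simp]:
  "cq_s 0 = 0" "cq_x 0 = 0" "cq_y 0 = 0" "cq_z 0 = 0"
  "cq_s 1 = 1" "cq_x 1 = 0" "cq_y 1 = 0" "cq_z 1 = 0"
  by (simp_all add: zero_cquat_def one_cquat_def)

lemma cq_uminus_simps [simp]:
  "cq_s (- p) = - cq_s p" "cq_x (- p) = - cq_x p"
  "cq_y (- p) = - cq_y p" "cq_z (- p) = - cq_z p"
  by (simp_all add: uminus_cquat_def)

text \<open>Allows division by 2 after a sum has been added to its reversal.\<close>

lemma cquat_double_eq_iff: "p + p = q + q \<longleftrightarrow> p = (q :: cquat)"
  by (cases p; cases q) (simp add: plus_cquat_def)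

lemma cq_conj_mult: "cq_conj (p * q) = cq_conj q * cq_conj p"
  by (simp add: cq_conj_def times_cquat_def algebra_simps)

lemma cq_conj_one [simp]: "cq_conj 1 = 1"
  by (simp add: cq_conj_def one_cquat_def)

lemma cq_conj_conj [simp]: "cq_conj (cq_conj q) = q"
  by (simp add: cq_conj_def)

lemma cq_conj_add: "cq_conj (p + q) = cq_conj p + cq_conj q"
  by (simp add: cq_conj_def plus_cquat_def)

lemma cq_conj_sum: "cq_conj (sum f A) = (\<Sum>i \<in> A. cq_conj (f i))"
proof (induction A rule: infinite_finite_induct)
  case (insert i A)
  then show ?case by (simp add: cq_conj_add)
qed (auto simp: cq_conj_def zero_cquat_def)

definition scal :: "cquat \<Rightarrow> cquat" where
  "scal q = CQ (cq_s q) 0 0 0"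

text \<open>The trace property: the scalar part of a closed walk does not depend on its starting
  point.\<close>

lemma scal_mult_commute: "scal (p * q) = scal (q * p)"
  by (simp add: scal_def times_cquat_def algebra_simps)

lemma scal_central: "scal p * q = q * scal p"
  unfolding scal_def by (rule cquat_scalar_central)

lemma add_cq_conj: "q + cq_conj q = scal q + scal q"
  by (simp add: scal_def cq_conj_def plus_cquat_def)

definition scalars :: "cquat set" where
  "scalars = range scal"

lemma scal_in_scalars [simp, intro]: "scal q \<in> scalars"
  by (simp add: scalars_def)

lemma scalars_iff: "q \<in> scalars \<longleftrightarrow> cq_x q = 0 \<and> cq_y q = 0 \<and> cq_z q = 0"
  by (cases q) (auto simp: scalars_def scal_def image_iff, metis cquat.sel(1))

lemma scalars_central: "p \<in> scalars \<Longrightarrow> p * q = q * p"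
  by (auto simp: scalars_def scal_central)

lemma scalars_closed [simp, intro]:
  "1 \<in> scalars" "0 \<in> scalars"
  "p \<in> scalars \<Longrightarrow> - p \<in> scalars"
  "p \<in> scalars \<Longrightarrow> q \<in> scalars \<Longrightarrow> p + q \<in> scalars"
  "p \<in> scalars \<Longrightarrow> q \<in> scalars \<Longrightarrow> p * q \<in> scalars"
  by (auto simp: scalars_iff times_cquat_def)

lemma scalars_power [simp, intro]: "p \<in> scalars \<Longrightarrow> p ^ k \<in> scalars"
  by (induction k) auto

lemma scalars_sum [intro]: "(\<And>i. i \<in> A \<Longrightarrow> f i \<in> scalars) \<Longrightarrow> sum f A \<in> scalars"
  by (induction A rule: infinite_finite_induct) auto


section \<open>Cramer's rule for self-dual matrices\<close>

lemma walk_append: "walk x (u @ b # v) = walk x (u @ [b]) * walk x (b # v)"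
proof (induction u)
  case (Cons a u)
  then show ?case
    by (cases u) (simp_all add: mult.assoc)
qed simp

text \<open>Conjugation reverses products and, by self-duality, swaps the two indices of each
  entry.\<close>

lemma cq_conj_walk:
  assumes "\<And>i j. x j i = cq_conj (x i j)"
  shows "cq_conj (walk x w) = walk x (rev w)"
proof (induction w rule: induct_list012)
  case (3 a b l)
  then show ?case
    using walk_append[of x "rev l" b "[a]"] by (simp add: cq_conj_mult assms[symmetric])
qed auto

text \<open>A repetition-free list either avoids \<open>b\<close> or splits uniquely at its single
  occurrence of \<open>b\<close>.\<close>

lemma sum_dlists_split:
  fixes F :: "'a list \<Rightarrow> 'b::comm_monoid_add"
  assumes "finite S" "b \<in> S"
  shows "sum F (dlists S) = sum F (dlists (S - {b}))
    + (\<Sum>u \<in> dlists (S - {b}). \<Sum>v \<in> dlists (S - {b} - set u). F (u @ b # v))"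
proof -
  define P where "P = (SIGMA u : dlists (S - {b}). dlists (S - {b} - set u))"
  define g where "g = (\<lambda>(u, v). u @ b # v)"
  have inj: "inj_on g P"
  proof (rule inj_onI, clarify)
    fix u v u' v' assume "(u, v) \<in> P" "(u', v') \<in> P" "g (u, v) = g (u', v')"
    then have "u @ b # v = u' @ b # v'" "b \<notin> set u" "b \<notin> set v"
      by (auto simp: P_def g_def dlists_def)
    then show "u = u' \<and> v = v'"
      by (simp add: append_Cons_eq_iff)
  qed
  have "dlists S = dlists (S - {b}) \<union> g ` P"
  proof (intro equalityI subsetI)
    fix l assume l: "l \<in> dlists S"
    show "l \<in> dlists (S - {b}) \<union> g ` P"
    proof (cases "b \<in> set l")
      case True
      then obtain u v where "l = u @ b # v"
        by (meson split_list)
      with l have "l = g (u, v)" "(u, v) \<in> P"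
        by (auto simp: g_def P_def dlists_def)
      then show ?thesis by blast
    qed (use l in \<open>auto simp: dlists_def\<close>)
  qed (use assms in \<open>auto simp: g_def P_def dlists_def\<close>)
  moreover have "dlists (S - {b}) \<inter> g ` P = {}"
    by (auto simp: g_def P_def dlists_def)
  moreover have "finite P"
    using assms by (auto simp: P_def)
  ultimately have "sum F (dlists S) = sum F (dlists (S - {b})) + sum F (g ` P)"
    using assms by (simp add: sum.union_disjoint)
  also have "sum F (g ` P) = (\<Sum>(u, v) \<in> P. F (u @ b # v))"
    by (subst sum.reindex[OF inj]) (simp add: g_def case_prod_unfold)
  also have "\<dots> = (\<Sum>u \<in> dlists (S - {b}). \<Sum>v \<in> dlists (S - {b} - set u). F (u @ b # v))"
    unfolding P_def using assms by (subst sum.Sigma) auto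
  finally show ?thesis .
qed

text \<open>Both sides run over the ordered pairs of disjoint repetition-free lists.\<close>

lemma sum_dlists_swap:
  assumes "finite S"
  shows "(\<Sum>u \<in> dlists S. \<Sum>v \<in> dlists (S - set u). G u v)
    = (\<Sum>v \<in> dlists S. \<Sum>u \<in> dlists (S - set v). G u v)"
proof -
  have "(\<Sum>u \<in> dlists S. \<Sum>v \<in> dlists (S - set u). G u v)
      = (\<Sum>u \<in> dlists S. \<Sum>v | v \<in> dlists S \<and> set u \<inter> set v = {}. G u v)"
    by (intro sum.cong) (auto simp: dlists_def)
  also have "\<dots> = (\<Sum>v \<in> dlists S. \<Sum>u | u \<in> dlists S \<and> set u \<inter> set v = {}. G u v)"
    using assms by (intro sum.swap_restrict) auto
  also have "\<dots> = (\<Sum>v \<in> dlists S. \<Sum>u \<in> dlists (S - set v). G u v)"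
    by (intro sum.cong) (auto simp: dlists_def)
  finally show ?thesis .
qed

section \<open>Scalar parts of cycles and expansion about an arbitrary index\<close>

context
  fixes x :: "'a::linorder \<Rightarrow> 'a \<Rightarrow> cquat"
  assumes self_dual: "\<And>i j. x j i = cq_conj (x i j)"
begin

text \<open>Reversal permutes the lists \<open>l\<close> and conjugates the closed walks, so adding
  the sum to its reversal turns each walk into twice its scalar part. The weight \<open>c\<close>
  must not see the direction of the cycle.\<close>

lemma sum_closed_walks:
  assumes "\<And>l. c (rev l) = c l"
  shows "(\<Sum>l \<in> dlists S. walk x (a # l @ [a]) * c l) = (\<Sum>l \<in> dlists S. scal (walk x (a # l @ [a])) * c l)"
proof -
  let ?T = "\<Sum>l \<in> dlists S. walk x (a # l @ [a]) * c l"
  have "bij_betw rev (dlists S) (dlists S)"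
    by (rule bij_betw_byWitness[of _ rev]) (auto simp: dlists_def)
  then have "?T = (\<Sum>l \<in> dlists S. walk x (a # rev l @ [a]) * c (rev l))"
    by (rule sum.reindex_bij_betw[symmetric])
  also have "\<dots> = (\<Sum>l \<in> dlists S. cq_conj (walk x (a # l @ [a])) * c l)"
    by (simp add: cq_conj_walk[OF self_dual] assms)
  finally have "?T + ?T = (\<Sum>l \<in> dlists S. (walk x (a # l @ [a]) + cq_conj (walk x (a # l @ [a]))) * c l)"
    by (simp add: sum.distrib distrib_right)
  then have "?T + ?T = (\<Sum>l \<in> dlists S. scal (walk x (a # l @ [a])) * c l)
      + (\<Sum>l \<in> dlists S. scal (walk x (a # l @ [a])) * c l)"
    by (simp add: add_cq_conj sum.distrib distrib_right)
  then show ?thesis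
    by (simp only: cquat_double_eq_iff)
qed

text \<open>The sign and the remaining determinant depend only on the length and the set of
  \<open>l\<close>, so they survive reversal; the sign is central and can be moved behind the
  walk.\<close>

lemma sum_closed_walks_det_on:
  "(\<Sum>l \<in> dlists (S - {a}). (- 1) ^ length l * walk x (a # l @ [a]) * det_on x (S - {a} - set l))
  = (\<Sum>l \<in> dlists (S - {a}). (- 1) ^ length l * scal (walk x (a # l @ [a])) * det_on x (S - {a} - set l))"
proof -
  have "(- 1) ^ k * p * q = p * ((- 1) ^ k * q)" for k and p q :: cquat
    by (subst scalars_central) (auto simp: mult.assoc)
  then show ?thesis
    by (simp only:) (rule sum_closed_walks, simp)
qed

lemma det_on_scalar: "finite S \<Longrightarrow> det_on x S \<in> scalars"
proof (induction "card S" arbitrary: S rule: less_induct)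
  case less
  show ?case
  proof (cases "S = {}")
    case False
    have "det_on x (S - {Max S} - set l) \<in> scalars" for l
    proof (rule less)
      have "card (S - {Max S} - set l) \<le> card (S - {Max S})"
        using less by (intro card_mono) auto
      also have "\<dots> < card S"
        using less False by (intro card_Diff1_less) auto
      finally show "card (S - {Max S} - set l) < card S" .
    qed (use less in auto)
    then show ?thesis
      unfolding det_on_Max[OF less(2) False] sum_closed_walks_det_on by auto
  qed auto
qed

text \<open>The sum of \<open>det_on_Max\<close> after passing to scalar parts, but with an
  arbitrary \<open>a\<close> in place of the maximum.\<close>

definition expansion :: "'a \<Rightarrow> 'a set \<Rightarrow> cquat" where
  "expansion a S = (\<Sum>l \<in> dlists (S - {a}).
     (- 1) ^ length l * scal (walk x (a # l @ [a])) * det_on x (S - {a} - set l))"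

text \<open>The right-hand side is symmetric in \<open>a\<close> and \<open>b\<close>: either \<open>b\<close> lies on another cycle than
  \<open>a\<close>, or on the same one.\<close>

lemma expansion_two:
  assumes S: "finite S" "a \<in> S" "b \<in> S" "a \<noteq> b"
    and expand: "\<And>l. l \<in> dlists (S - {a} - {b}) \<Longrightarrow> det_on x (S - {a} - set l) = expansion b (S - {a} - set l)"
  defines "T \<equiv> S - {a} - {b}"
  shows "expansion a S = (\<Sum>u \<in> dlists T. \<Sum>v \<in> dlists (T - set u).
      (- 1) ^ length u * (- 1) ^ length v *
      (scal (walk x (a # u @ [a])) * scal (walk x (b # v @ [b]))
        - scal (walk x (a # u @ [b]) * walk x (b # v @ [a]))) * det_on x (T - set u - set v))"
proof -
  \<comment> \<open>Here \<open>b\<close> is off the cycle of \<open>a\<close>, and the remaining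
    determinant is expanded about \<open>b\<close>.\<close>
  have 1: "(- 1) ^ length u * scal (walk x (a # u @ [a])) * det_on x (S - {a} - set u)
    = (\<Sum>v \<in> dlists (T - set u). (- 1) ^ length u * (- 1) ^ length v *
      (scal (walk x (a # u @ [a])) * scal (walk x (b # v @ [b]))) * det_on x (T - set u - set v))"
    if u: "u \<in> dlists T" for u
  proof -
    have T: "S - {a} - set u - {b} = T - set u"
      unfolding T_def by blast
    have "p * q * (r * s * t) = p * r * (q * s) * t" if "r \<in> scalars" for p q r s t
      using scalars_central[OF that, of q] by (simp add: mult.assoc) (metis mult.assoc)
    then show ?thesis
      using expand[of u] u unfolding expansion_def T T_def[symmetric]
      by (simp add: sum_distrib_left)
  qed
  \<comment> \<open>Here \<open>b\<close> is on the cycle of \<open>a\<close>, which is cut at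
    \<open>b\<close>; counting \<open>b\<close> in the length gives the extra minus sign.\<close>
  have 2: "(- 1) ^ length (u @ b # v) * scal (walk x (a # (u @ b # v) @ [a])) * det_on x (S - {a} - set (u @ b # v))
    = - ((- 1) ^ length u * (- 1) ^ length v *
        scal (walk x (a # u @ [b]) * walk x (b # v @ [a])) * det_on x (T - set u - set v))" for u v
  proof -
    have "S - {a} - set (u @ b # v) = T - set u - set v"
      unfolding T_def by auto
    moreover have "walk x (a # (u @ b # v) @ [a]) = walk x (a # u @ [b]) * walk x (b # v @ [a])"
      using walk_append[of x "a # u" b "v @ [a]"] by simp
    ultimately show ?thesis
      by (simp add: power_add)
  qed
  have "expansion a S = (\<Sum>u \<in> dlists T. (- 1) ^ length u * scal (walk x (a # u @ [a])) * det_on x (S - {a} - set u))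
    + (\<Sum>u \<in> dlists T. \<Sum>v \<in> dlists (T - set u). (- 1) ^ length (u @ b # v) * scal (walk x (a # (u @ b # v) @ [a]))
       * det_on x (S - {a} - set (u @ b # v)))"
    unfolding expansion_def T_def using S by (intro sum_dlists_split) auto
  then show ?thesis
    unfolding 2 by (simp add: 1 sum.distrib[symmetric] ring_distribs sum_subtractf sum_negf)
qed

text \<open>Induction on the size of \<open>S\<close>. For the maximum this is
  \<open>det_on_Max\<close>; the symmetry of \<open>expansion_two\<close> carries it over to any
  other index, the induction hypothesis expanding the smaller determinants.\<close>

lemma det_on_expansion: "finite S \<Longrightarrow> a \<in> S \<Longrightarrow> det_on x S = expansion a S"
proof (induction "card S" arbitrary: S a rule: less_induct)
  case less
  define b where "b = Max S"
  have b: "b \<in> S"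
    unfolding b_def using less by (intro Max_in) auto
  have "det_on x S = expansion b S"
    unfolding b_def using less det_on_Max[of S x] unfolding sum_closed_walks_det_on expansion_def by auto
  also have "expansion b S = expansion a S"
  proof (cases "a = b")
    case False
    have IH: "det_on x (S - {c} - set l) = expansion d (S - {c} - set l)"
      if "c \<in> S" "d \<in> S" "c \<noteq> d" "l \<in> dlists (S - {c} - {d})" for c d l
    proof (rule less(1))
      have "card (S - {c} - set l) \<le> card (S - {c})"
        using less by (intro card_mono) auto
      also have "\<dots> < card S"
        using less that by (intro card_Diff1_less) auto
      finally show "card (S - {c} - set l) < card S" .
    qed (use less that in \<open>auto simp: dlists_def\<close>)
    define T where "T = S - {a} - {b}"
    have T: "S - {b} - {a} = T"
      unfolding T_def by blast
    have fin: "finite T"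
      using less by (simp add: T_def)
    have "expansion b S = (\<Sum>u \<in> dlists T. \<Sum>v \<in> dlists (T - set u).
      (- 1) ^ length u * (- 1) ^ length v *
      (scal (walk x (b # u @ [b])) * scal (walk x (a # v @ [a]))
        - scal (walk x (b # u @ [a]) * walk x (a # v @ [b]))) * det_on x (T - set u - set v))"
      using expansion_two[OF less(2) b less(3) _ IH] False b less(3) unfolding T by auto
    \<comment> \<open>Swapping the two lists, together with the centrality and the trace property of
      \<open>scal\<close>, interchanges the roles of \<open>a\<close> and \<open>b\<close>.\<close>
    also have "\<dots> = (\<Sum>v \<in> dlists T. \<Sum>u \<in> dlists (T - set v).
      (- 1) ^ length u * (- 1) ^ length v *
      (scal (walk x (b # u @ [b])) * scal (walk x (a # v @ [a]))
        - scal (walk x (b # u @ [a]) * walk x (a # v @ [b]))) * det_on x (T - set u - set v))"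
      by (rule sum_dlists_swap[OF fin])
    also have "\<dots> = (\<Sum>v \<in> dlists T. \<Sum>u \<in> dlists (T - set v).
      (- 1) ^ length v * (- 1) ^ length u *
      (scal (walk x (a # v @ [a])) * scal (walk x (b # u @ [b]))
        - scal (walk x (a # v @ [b]) * walk x (b # u @ [a]))) * det_on x (T - set v - set u))"
    proof (intro sum.cong refl)
      fix u v
      have "T - set u - set v = T - set v - set u"
        by blast
      then show "(- 1) ^ length u * (- 1) ^ length v *
      (scal (walk x (b # u @ [b])) * scal (walk x (a # v @ [a]))
        - scal (walk x (b # u @ [a]) * walk x (a # v @ [b]))) * det_on x (T - set u - set v)
        = (- 1) ^ length v * (- 1) ^ length u *
      (scal (walk x (a # v @ [a])) * scal (walk x (b # u @ [b]))
        - scal (walk x (a # v @ [b]) * walk x (b # u @ [a]))) * det_on x (T - set v - set u)"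
        by (simp only: scal_mult_commute[of "walk x (b # u @ [a])"] scal_central[of "walk x (b # u @ [b])"]
          power_add[symmetric] add.commute[of "length u"])
    qed
    also have "\<dots> = expansion a S"
      using expansion_two[OF less(2) less(3) b False IH] False b less(3) unfolding T_def by auto
    finally show ?thesis .
  qed simp
  finally show ?case .
qed

text \<open>Read as a path from \<open>b\<close> to \<open>a\<close>: the list \<open>l @ [a]\<close> starts at \<open>b\<close>, with \<open>l\<close> empty if
  \<open>b = a\<close>.\<close>

definition walk_cofactor :: "'a set \<Rightarrow> 'a \<Rightarrow> 'a \<Rightarrow> cquat" where
  "walk_cofactor S b a = (\<Sum>l | l \<in> dlists (S - {a}) \<and> hd (l @ [a]) = b.
     (- 1) ^ length l * walk x (l @ [a]) * det_on x (S - {a} - set l))"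

text \<open>The entry \<open>x c b\<close> prepends \<open>c\<close> to a path from \<open>b\<close>
  to \<open>a\<close>, and the sum over \<open>b\<close> removes the condition on the first
  vertex.\<close>

lemma walk_cofactor_sum:
  assumes S: "finite S" "a \<in> S"
  shows "(\<Sum>b \<in> S. x c b * walk_cofactor S b a)
    = (\<Sum>l \<in> dlists (S - {a}). (- 1) ^ length l * walk x (c # l @ [a]) * det_on x (S - {a} - set l))"
proof -
  have "x c b * ((- 1) ^ length l * walk x (l @ [a]) * d) = (- 1) ^ length l * walk x (c # l @ [a]) * d"
    if "hd (l @ [a]) = b" for b l d
  proof -
    have "walk x (c # l @ [a]) = x c b * walk x (l @ [a])"
      using that by (cases l) auto
    moreover have "x c b * (- 1) ^ length l = (- 1) ^ length l * x c b"
      by (rule scalars_central[symmetric]) auto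
    ultimately show ?thesis
      by (metis mult.assoc)
  qed
  then have "(\<Sum>b \<in> S. x c b * walk_cofactor S b a) = (\<Sum>b \<in> S. \<Sum>l | l \<in> dlists (S - {a}) \<and> hd (l @ [a]) = b.
      (- 1) ^ length l * walk x (c # l @ [a]) * det_on x (S - {a} - set l))"
    unfolding walk_cofactor_def sum_distrib_left by (intro sum.cong refl) auto
  also have "\<dots> = (\<Sum>l \<in> dlists (S - {a}). (- 1) ^ length l * walk x (c # l @ [a]) * det_on x (S - {a} - set l))"
  proof (rule sum.group)
    show "(\<lambda>l. hd (l @ [a])) ` dlists (S - {a}) \<subseteq> S"
    proof clarify
      fix l assume "l \<in> dlists (S - {a})"
      with S(2) show "hd (l @ [a]) \<in> S"
        by (cases l) (auto simp: dlists_def)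
    qed
  qed (use S in auto)
  finally show ?thesis .
qed

text \<open>Off the diagonal, a path from \<open>c\<close> to \<open>a\<close> that returns to \<open>c\<close> cancels against the path
  from \<open>c\<close> to \<open>a\<close> accompanied by the cut-off loop as a cycle of the remaining permutation.\<close>

lemma cramer:
  assumes S: "finite S" "a \<in> S" "c \<in> S"
  shows "(\<Sum>b \<in> S. x c b * walk_cofactor S b a) = (if c = a then det_on x S else 0)"
proof (cases "c = a")
  case True
  then show ?thesis
    using det_on_expansion[OF S(1,2)] unfolding walk_cofactor_sum[OF S(1,2)] True
    by (simp add: expansion_def sum_closed_walks_det_on)
next
  case False
  define T where "T = S - {a} - {c}"
  have fin: "finite T"
    using S by (simp add: T_def)
  let ?F = "\<lambda>l. (- 1) ^ length l * walk x (c # l @ [a]) * det_on x (S - {a} - set l)"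
  let ?G = "\<lambda>v u. scal (walk x (c # u @ [c])) *
       ((- 1) ^ length u * (- 1) ^ length v * walk x (c # v @ [a]) * det_on x (T - set v - set u))"
  \<comment> \<open>Paths that do not return to \<open>c\<close>: expanding the remaining
    determinant about \<open>c\<close> produces a loop at \<open>c\<close>.\<close>
  have 1: "?F v = (\<Sum>u \<in> dlists (T - set v). ?G v u)" if v: "v \<in> dlists T" for v
  proof -
    have T: "S - {a} - set v - {c} = T - set v"
      unfolding T_def by blast
    have "det_on x (S - {a} - set v) = expansion c (S - {a} - set v)"
      by (rule det_on_expansion) (use S False v in \<open>auto simp: T_def dlists_def\<close>)
    moreover have "p * q * (r * scal s * t) = scal s * (r * p * q * t)" if "r \<in> scalars" for p q r s t
    proof -
      have "p * q * (r * scal s * t) = p * q * (scal s * (r * t))"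
        by (simp add: mult.assoc scal_central)
      also have "\<dots> = scal s * (p * q) * (r * t)"
        by (simp add: mult.assoc scal_central)
      also have "\<dots> = scal s * (r * (p * q) * t)"
        by (simp add: scalars_central[OF that, of "p * q"] mult.assoc)
      finally show ?thesis
        by (simp add: mult.assoc)
    qed
    ultimately show ?thesis
      unfolding expansion_def T by (simp add: sum_distrib_left)
  qed
  \<comment> \<open>Paths that return to \<open>c\<close>: the walk factors into a loop at
    \<open>c\<close> and a path, and the extra vertex reverses the sign.\<close>
  have 2: "?F (u @ c # v) = - (walk x (c # u @ [c]) *
      ((- 1) ^ length u * (- 1) ^ length v * walk x (c # v @ [a]) * det_on x (T - set v - set u)))" for u v
  proof -
    have "S - {a} - set (u @ c # v) = T - set v - set u"
      unfolding T_def by auto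
    moreover have "walk x (c # (u @ c # v) @ [a]) = walk x (c # u @ [c]) * walk x (c # v @ [a])"
      using walk_append[of x "c # u" c "v @ [a]"] by simp
    moreover have "r * (p * q) * t = p * (r * q * t)" if "r \<in> scalars" for p q r t
      using scalars_central[OF that, of p] by (simp add: mult.assoc) (metis mult.assoc)
    ultimately show ?thesis
      by (simp add: power_add[symmetric])
  qed
  have "sum ?F (dlists (S - {a})) = sum ?F (dlists T)
      + (\<Sum>u \<in> dlists T. \<Sum>v \<in> dlists (T - set u). ?F (u @ c # v))"
    unfolding T_def using S False by (intro sum_dlists_split) auto
  also have "(\<Sum>u \<in> dlists T. \<Sum>v \<in> dlists (T - set u). ?F (u @ c # v))
      = (\<Sum>v \<in> dlists T. \<Sum>u \<in> dlists (T - set v). ?F (u @ c # v))"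
    by (rule sum_dlists_swap[OF fin])
  \<comment> \<open>Summed over all \<open>u\<close>, the loop factor may be replaced by its scalar
    part, which matches the terms of the first kind.\<close>
  also have "\<dots> = (\<Sum>v \<in> dlists T. - (\<Sum>u \<in> dlists (T - set v). ?G v u))"
    unfolding 2 sum_negf by (intro sum.cong refl arg_cong[of _ _ uminus] sum_closed_walks) simp
  finally show ?thesis
    unfolding walk_cofactor_sum[OF S(1,2)] using False by (simp add: 1 sum_negf)
qed

end


section \<open>Gram matrices of few rows\<close>

text \<open>Padding both factors with zeros to \<open>n\<close> by \<open>n\<close> matrices makes
  \<open>d ^ n\<close> a product of two determinants; the first vanishes because column
  \<open>k\<close> of \<open>A'\<close> is zero.\<close>

lemma scalar_factorisation_eq_zero:
  fixes A B :: "nat \<Rightarrow> nat \<Rightarrow> 'a::field"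
  assumes "k < n"
    and AB: "\<And>i j. i < n \<Longrightarrow> j < n \<Longrightarrow> (\<Sum>t<k. A i t * B t j) = (if i = j then d else 0)"
  shows "d = 0"
proof -
  define A' where "A' = mat n n (\<lambda>(i, t). if t < k then A i t else 0)"
  define B' where "B' = mat n n (\<lambda>(t, j). if t < k then B t j else 0)"
  have carrier: "A' \<in> carrier_mat n n" "B' \<in> carrier_mat n n"
    by (auto simp: A'_def B'_def)
  have "A' * B' = d \<cdot>\<^sub>m 1\<^sub>m n"
  proof (rule eq_matI)
    fix i j assume "i < dim_row (d \<cdot>\<^sub>m 1\<^sub>m n)" "j < dim_col (d \<cdot>\<^sub>m 1\<^sub>m n)"
    then have ij: "i < n" "j < n" by auto
    then have "(A' * B') $$ (i, j) = (\<Sum>t\<in>{0..<n}. if t < k then A i t * B t j else 0)"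
      by (auto simp: A'_def B'_def scalar_prod_def intro!: sum.cong)
    also have "\<dots> = (\<Sum>t<k. A i t * B t j)"
      using \<open>k < n\<close> by (intro sum.mono_neutral_cong_right) auto
    finally show "(A' * B') $$ (i, j) = (d \<cdot>\<^sub>m 1\<^sub>m n) $$ (i, j)"
      using AB[OF ij] ij by simp
  qed (auto simp: A'_def B'_def)
  then have "det A' * det B' = d ^ n"
    using det_mult[OF carrier] by simp
  moreover have "det A' = 0"
    unfolding det_0_iff_vec_prod_zero_field[OF carrier(1)]
  proof (intro exI conjI)
    show "A' *\<^sub>v unit_vec n k = 0\<^sub>v n"
      using \<open>k < n\<close> by (intro eq_vecI) (auto simp: A'_def)
    show "unit_vec n k \<noteq> 0\<^sub>v n"
      using \<open>k < n\<close> by simp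
  qed simp
  ultimately show ?thesis
    by simp
qed

text \<open>The isomorphism with complex 2 by 2 matrices. Every index other than 0 stands for the
  second row or column, so the rules below need no bounds on \<open>r\<close> and
  \<open>t\<close>.\<close>

definition cq_rep :: "cquat \<Rightarrow> nat \<Rightarrow> nat \<Rightarrow> complex" where
  "cq_rep q r t =
    (if r = 0 then (if t = 0 then cq_s q + \<i> * cq_x q else cq_y q + \<i> * cq_z q)
     else (if t = 0 then - cq_y q + \<i> * cq_z q else cq_s q - \<i> * cq_x q))"

lemma cq_rep_mult: "cq_rep (p * q) r t = (\<Sum>u<2. cq_rep p r u * cq_rep q u t)"
proof -
  have ii: "\<i> * (\<i> * z) = - z" for z :: complex
    by (simp add: mult.assoc[symmetric])
  have "{..<2::nat} = {0, 1}" by auto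
  then show ?thesis
    by (auto simp: cq_rep_def times_cquat_def algebra_simps ii)
qed

lemma cq_rep_add: "cq_rep (p + q) r t = cq_rep p r t + cq_rep q r t"
  by (simp add: cq_rep_def algebra_simps)

lemma cq_rep_sum: "cq_rep (sum f A) r t = (\<Sum>i \<in> A. cq_rep (f i) r t)"
  by (induction A rule: infinite_finite_induct) (simp_all add: cq_rep_add, simp_all add: cq_rep_def)

lemma sum_div_mod_2:
  fixes f :: "nat \<Rightarrow> nat \<Rightarrow> 'a::comm_monoid_add"
  shows "(\<Sum>t<2 * k. f (t div 2) (t mod 2)) = (\<Sum>b<k. \<Sum>u<2. f b u)"
proof (induction k)
  case (Suc k)
  have "{..<2::nat} = {0, 1}" by auto
  with Suc show ?case by (simp add: add.assoc)
qed simp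

text \<open>Replacing each quaternion by its 2 by 2 block doubles both sizes, and a scalar becomes a
  multiple of the identity block, so the complex case applies with
  \<open>2 * k < 2 * n\<close>.\<close>

lemma cquat_scalar_factorisation_eq_zero:
  fixes P Q :: "nat \<Rightarrow> nat \<Rightarrow> cquat"
  assumes "k < n" and d: "d \<in> scalars"
    and PQ: "\<And>c a. c < n \<Longrightarrow> a < n \<Longrightarrow> (\<Sum>t<k. P c t * Q t a) = (if c = a then d else 0)"
  shows "d = 0"
proof -
  define A where "A i t = cq_rep (P (i div 2) (t div 2)) (i mod 2) (t mod 2)" for i t
  define B where "B t j = cq_rep (Q (t div 2) (j div 2)) (t mod 2) (j mod 2)" for t j
  have "cq_s d = 0"
  proof (rule scalar_factorisation_eq_zero)
    show "2 * k < 2 * n" using \<open>k < n\<close> by simp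
    fix i j assume ij: "i < 2 * n" "j < 2 * n"
    have "(\<Sum>t<2 * k. A i t * B t j)
      = (\<Sum>b<k. \<Sum>u<2. cq_rep (P (i div 2) b) (i mod 2) u * cq_rep (Q b (j div 2)) u (j mod 2))"
      unfolding A_def B_def by (rule sum_div_mod_2)
    also have "\<dots> = cq_rep (\<Sum>b<k. P (i div 2) b * Q b (j div 2)) (i mod 2) (j mod 2)"
      by (simp add: cq_rep_mult cq_rep_sum)
    also have "\<dots> = cq_rep (if i div 2 = j div 2 then d else 0) (i mod 2) (j mod 2)"
      using ij by (subst PQ) auto
    also have "\<dots> = (if i div 2 = j div 2 \<and> i mod 2 = j mod 2 then cq_s d else 0)"
      using d by (auto simp: cq_rep_def scalars_iff)
    also have "(i div 2 = j div 2 \<and> i mod 2 = j mod 2) = (i = j)"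
      by (metis div_mult_mod_eq)
    finally show "(\<Sum>t<2 * k. A i t * B t j) = (if i = j then cq_s d else 0)" .
  qed
  with d show ?thesis
    by (cases d) (simp add: scalars_iff zero_cquat_def)
qed

text \<open>A sum over a set needs no order of the rows and is visibly additive in
  \<open>J\<close>.\<close>

definition gram :: "('i \<Rightarrow> 'a \<Rightarrow> cquat) \<Rightarrow> 'i set \<Rightarrow> 'a \<Rightarrow> 'a \<Rightarrow> cquat" where
  "gram w J k l = (\<Sum>i \<in> J. cq_conj (w i k) * w i l)"

lemma gram_self_dual: "gram w J l k = cq_conj (gram w J k l)"
  by (simp add: gram_def cq_conj_sum cq_conj_mult)

text \<open>By \<open>cramer\<close>, the Gram matrix times its cofactor matrix is the determinant
  times the identity. Regrouped as \<open>P\<close> times \<open>Q\<close>, with the inner index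
  running over only \<open>card J\<close> rows, this forces the scalar determinant to be 0.\<close>

lemma det_on_gram_eq_zero:
  fixes w :: "'i \<Rightarrow> nat \<Rightarrow> cquat"
  assumes J: "finite J" "card J < m"
  shows "det_on (gram w J) {0..<m} = 0"
proof -
  obtain e where e: "bij_betw e {0..<card J} J"
    using ex_bij_betw_nat_finite[OF J(1)] by blast
  define P where "P c t = cq_conj (w (e t) c)" for c t
  define Q where "Q t a = (\<Sum>b \<in> {0..<m}. w (e t) b * walk_cofactor (gram w J) {0..<m} b a)" for t a
  show ?thesis
  proof (rule cquat_scalar_factorisation_eq_zero[OF J(2), of _ P Q])
    show "det_on (gram w J) {0..<m} \<in> scalars"
      by (rule det_on_scalar[OF gram_self_dual]) simp
    fix c a assume ca: "c < m" "a < m"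
    have "(\<Sum>t<card J. P c t * Q t a)
        = (\<Sum>b \<in> {0..<m}. \<Sum>t \<in> {0..<card J}. cq_conj (w (e t) c) * w (e t) b * walk_cofactor (gram w J) {0..<m} b a)"
      unfolding P_def Q_def sum_distrib_left
      by (subst sum.swap) (simp add: mult.assoc lessThan_atLeast0)
    also have "\<dots> = (\<Sum>b \<in> {0..<m}. gram w J c b * walk_cofactor (gram w J) {0..<m} b a)"
      unfolding gram_def sum_distrib_right
      by (intro sum.cong refl sum.reindex_bij_betw[OF e, of "\<lambda>i. cq_conj (w i c) * w i _ * walk_cofactor _ _ _ _"])
    also have "\<dots> = (if c = a then det_on (gram w J) {0..<m} else 0)"
      using ca by (intro cramer[OF gram_self_dual]) auto
    finally show "(\<Sum>t<card J. P c t * Q t a) = (if c = a then det_on (gram w J) {0..<m} else 0)" .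
  qed
qed


section \<open>Set functions of bounded degree\<close>

text \<open>As a polynomial in the indicator variables of the elements, \<open>g\<close> has degree
  at most \<open>d\<close>; \<open>h K\<close> is the coefficient of the squarefree monomial of
  \<open>K\<close>.\<close>

definition set_degree_le :: "nat \<Rightarrow> ('i set \<Rightarrow> 'b::ring_1) \<Rightarrow> bool" where
  "set_degree_le d g \<longleftrightarrow> (\<exists>h. \<forall>J. finite J \<longrightarrow> g J = (\<Sum>K | K \<subseteq> J \<and> card K \<le> d. h K))"

lemma set_degree_le_mono:
  assumes "set_degree_le d g" "d \<le> e"
  shows "set_degree_le e g"
proof -
  obtain h where h: "\<And>J. finite J \<Longrightarrow> g J = (\<Sum>K | K \<subseteq> J \<and> card K \<le> d. h K)"
    using assms unfolding set_degree_le_def by blast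
  have "g J = (\<Sum>K | K \<subseteq> J \<and> card K \<le> e. if card K \<le> d then h K else 0)" if "finite J" for J
    unfolding h[OF that] using that assms(2)
    by (intro sum.mono_neutral_cong_left) auto
  then show ?thesis
    unfolding set_degree_le_def by blast
qed

lemma set_degree_le_const: "set_degree_le 0 (\<lambda>J. c)"
proof -
  have "c = (\<Sum>K | K \<subseteq> J \<and> card K \<le> 0. if K = {} then c else 0)" if "finite J" for J :: "'a set"
  proof -
    \<comment> \<open>Infinite sets also have \<open>card\<close> 0; the finiteness of
      \<open>J\<close> excludes them.\<close>
    have "{K. K \<subseteq> J \<and> card K \<le> 0} = {{}}"
      using that by (auto dest: finite_subset)
    then show ?thesis by simp
  qed
  then show ?thesis
    unfolding set_degree_le_def by (intro exI[of _ "\<lambda>K. if K = {} then c else 0"]) auto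
qed

lemma set_degree_le_add:
  assumes "set_degree_le d f" "set_degree_le d g"
  shows "set_degree_le d (\<lambda>J. f J + g J)"
proof -
  obtain h where h: "\<And>J. finite J \<Longrightarrow> f J = (\<Sum>K | K \<subseteq> J \<and> card K \<le> d. h K)"
    using assms unfolding set_degree_le_def by blast
  obtain h' where h': "\<And>J. finite J \<Longrightarrow> g J = (\<Sum>K | K \<subseteq> J \<and> card K \<le> d. h' K)"
    using assms unfolding set_degree_le_def by blast
  show ?thesis
    unfolding set_degree_le_def
    by (intro exI[of _ "\<lambda>K. h K + h' K"]) (simp add: h h' sum.distrib)
qed

lemma set_degree_le_sum:
  "(\<And>i. i \<in> A \<Longrightarrow> set_degree_le d (f i)) \<Longrightarrow> set_degree_le d (\<lambda>J. \<Sum>i \<in> A. f i J)"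
proof (induction A rule: infinite_finite_induct)
  case (insert i A)
  then show ?case
    using set_degree_le_add[of d "f i"] by simp
qed (use set_degree_le_mono[OF set_degree_le_const] in auto)

lemma set_degree_le_mult:
  fixes f g :: "'i set \<Rightarrow> 'b::ring_1"
  assumes "set_degree_le d f" "set_degree_le e g"
  shows "set_degree_le (d + e) (\<lambda>J. f J * g J)"
proof -
  obtain h where h: "\<And>J. finite J \<Longrightarrow> f J = (\<Sum>K | K \<subseteq> J \<and> card K \<le> d. h K)"
    using assms unfolding set_degree_le_def by blast
  obtain h' where h': "\<And>J. finite J \<Longrightarrow> g J = (\<Sum>K | K \<subseteq> J \<and> card K \<le> e. h' K)"
    using assms unfolding set_degree_le_def by blast
  \<comment> \<open>Indicators are idempotent, so the monomials of \<open>A\<close> and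
    \<open>B\<close> multiply to that of \<open>A \<union> B\<close>; \<open>H\<close> collects the
    coefficients.\<close>
  define H where "H K = (\<Sum>(A, B) | A \<union> B = K \<and> card A \<le> d \<and> card B \<le> e. h A * h' B)" for K
  have "f J * g J = (\<Sum>K | K \<subseteq> J \<and> card K \<le> d + e. H K)" if J: "finite J" for J
  proof -
    define P where "P = {A. A \<subseteq> J \<and> card A \<le> d} \<times> {B. B \<subseteq> J \<and> card B \<le> e}"
    have "f J * g J = (\<Sum>(A, B) \<in> P. h A * h' B)"
      unfolding h[OF J] h'[OF J] sum_product sum.cartesian_product P_def ..
    also have "\<dots> = (\<Sum>K | K \<subseteq> J \<and> card K \<le> d + e.
        \<Sum>(A, B) | (A, B) \<in> P \<and> A \<union> B = K. h A * h' B)"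
    proof -
      have "(\<lambda>(A, B). A \<union> B) ` P \<subseteq> {K. K \<subseteq> J \<and> card K \<le> d + e}"
        by (auto simp: P_def intro: order_trans[OF card_Un_le] add_mono)
      then have "(\<Sum>K | K \<subseteq> J \<and> card K \<le> d + e.
          \<Sum>p | p \<in> P \<and> (\<lambda>(A, B). A \<union> B) p = K. (\<lambda>(A, B). h A * h' B) p) = (\<Sum>(A, B) \<in> P. h A * h' B)"
        using J by (intro sum.group) (auto simp: P_def)
      moreover have "{p. p \<in> P \<and> (\<lambda>(A, B). A \<union> B) p = K} = {(A, B). (A, B) \<in> P \<and> A \<union> B = K}" for K
        by auto
      ultimately show ?thesis
        by simp
    qed
    also have "\<dots> = (\<Sum>K | K \<subseteq> J \<and> card K \<le> d + e. H K)"
      unfolding H_def by (intro sum.cong refl) (auto simp: P_def)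
    finally show ?thesis .
  qed
  then show ?thesis
    unfolding set_degree_le_def by blast
qed

lemma set_degree_le_linear: "set_degree_le 1 (\<lambda>J. \<Sum>i \<in> J. c i)"
proof -
  have "(\<Sum>i \<in> J. c i) = (\<Sum>K | K \<subseteq> J \<and> card K \<le> 1. if card K = 1 then c (the_elem K) else 0)"
    if J: "finite J" for J
  proof -
    have "(\<Sum>i \<in> J. c i) = (\<Sum>K \<in> (\<lambda>i. {i}) ` J. c (the_elem K))"
      by (subst sum.reindex) auto
    also have "\<dots> = (\<Sum>K | K \<subseteq> J \<and> card K \<le> 1. if card K = 1 then c (the_elem K) else 0)"
      using J by (intro sum.mono_neutral_cong_left) (auto simp: card_1_singleton_iff)
    finally show ?thesis .
  qed
  then show ?thesis
    unfolding set_degree_le_def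
    by (intro exI[of _ "\<lambda>K. if card K = 1 then c (the_elem K) else 0"]) blast
qed

lemma set_degree_le_walk:
  assumes "\<And>a b. set_degree_le 1 (\<lambda>J. x J a b)"
  shows "set_degree_le (length w - 1) (\<lambda>J. walk (x J) w)"
proof (induction w rule: induct_list012)
  case (3 a b l)
  then show ?case
    using set_degree_le_mult[OF assms[of a b] 3(2)] by simp
qed (auto simp: set_degree_le_const)

text \<open>In \<open>det_on_Max\<close>, a cycle with \<open>length l + 1\<close> indices
  contributes that many entries and removes that many indices from \<open>S\<close>, so the degrees
  add up to \<open>card S\<close>.\<close>

lemma set_degree_le_det_on:
  assumes x: "\<And>a b. set_degree_le 1 (\<lambda>J. x J a b)"
  shows "finite S \<Longrightarrow> set_degree_le (card S) (\<lambda>J. det_on (x J) S)"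
proof (induction "card S" arbitrary: S rule: less_induct)
  case less
  show ?case
  proof (cases "S = {}")
    case True
    then show ?thesis by (simp add: set_degree_le_const)
  next
    case False
    define a where "a = Max S"
    have a: "a \<in> S"
      unfolding a_def using less False by (intro Max_in)
    have "set_degree_le (card S) (\<lambda>J. (- 1) ^ length l * walk (x J) (a # l @ [a]) * det_on (x J) (S - {a} - set l))"
      if l: "l \<in> dlists (S - {a})" for l
    proof -
      have "distinct (a # l)" "insert a (set l) \<subseteq> S"
        using l a by (auto simp: dlists_def)
      then have "card (insert a (set l)) = Suc (length l)" "insert a (set l) \<subseteq> S"
        using distinct_card[of "a # l"] by auto
      moreover have "S - {a} - set l = S - insert a (set l)"
        by blast
      ultimately have card: "card S = Suc (length l) + card (S - {a} - set l)"
        using less(2) card_mono[of S "insert a (set l)"] by (simp add: card_Diff_subset)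
      have "set_degree_le (card (S - {a} - set l)) (\<lambda>J. det_on (x J) (S - {a} - set l))"
        using less card by (intro less(1)) auto
      moreover have "set_degree_le (Suc (length l)) (\<lambda>J. walk (x J) (a # l @ [a]))"
        using set_degree_le_walk[OF x, of "a # l @ [a]"] by simp
      ultimately show ?thesis
        unfolding card
        using set_degree_le_mult[OF set_degree_le_mult[OF set_degree_le_const]] by fastforce
    qed
    then show ?thesis
      unfolding det_on_Max[OF less(2) False] a_def[symmetric] by (intro set_degree_le_sum)
  qed
qed

text \<open>If \<open>card K\<close> is at most \<open>d\<close>, then by induction \<open>h\<close>
  agrees with \<open>g\<close> on the proper subsets of \<open>K\<close>, hence vanishes there, and
  the sum for \<open>g K\<close> reduces to \<open>h K\<close>.\<close>

lemma set_degree_le_eq_sum: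
  assumes g: "set_degree_le d g" and zero: "\<And>J. finite J \<Longrightarrow> card J < d \<Longrightarrow> g J = 0"
    and N: "finite N"
  shows "g N = (\<Sum>K | K \<subseteq> N \<and> card K = d. g K)"
proof -
  obtain h where h: "\<And>J. finite J \<Longrightarrow> g J = (\<Sum>K | K \<subseteq> J \<and> card K \<le> d. h K)"
    using g unfolding set_degree_le_def by blast
  have eq: "h K = g K" if "finite K" "card K \<le> d" for K
    using that
  proof (induction "card K" arbitrary: K rule: less_induct)
    case less
    have "h L = 0" if "L \<subset> K" for L
    proof -
      have "card L < card K" "finite L"
        using that less by (auto simp: psubset_card_mono intro: finite_subset)
      then show ?thesis
        using less zero[of L] by simp
    qed
    then have "(\<Sum>L | L \<subseteq> K \<and> card L \<le> d. h L) = (\<Sum>L \<in> {K}. h L)"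
      using less by (intro sum.mono_neutral_right) auto
    with h[of K] less show ?case by simp
  qed
  have "g N = (\<Sum>K | K \<subseteq> N \<and> card K \<le> d. g K)"
    unfolding h[OF N]
  proof (rule sum.cong)
    fix K assume "K \<in> {K. K \<subseteq> N \<and> card K \<le> d}"
    then have "finite K" "card K \<le> d"
      using N finite_subset by auto
    then show "h K = g K"
      by (rule eq)
  qed simp
  also have "\<dots> = (\<Sum>K | K \<subseteq> N \<and> card K = d. g K)"
  proof (intro sum.mono_neutral_right ballI)
    fix K assume "K \<in> {K. K \<subseteq> N \<and> card K \<le> d} - {K. K \<subseteq> N \<and> card K = d}"
    then have "finite K" "card K < d"
      using N finite_subset by auto
    then show "g K = 0"
      by (rule zero)
  qed (use N in auto)
  finally show ?thesis .
qed


section \<open>The Cauchy-Binet formula\<close>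

lemma det_on_cong:
  assumes "\<And>i j. i \<in> S \<Longrightarrow> j \<in> S \<Longrightarrow> x i j = y i j"
  shows "det_on x S = det_on y S"
proof -
  have walk: "orbit_walk x p a = orbit_walk y p a" if "p permutes S" "a \<in> S" for p a
  proof -
    have "(p ^^ t) a \<in> S" for t
      using that permutes_in_image[OF permutes_funpow[OF that(1)]] by blast
    then show ?thesis
      unfolding orbit_walk_def by (intro arg_cong[of _ _ prod_list] map_cong refl assms)
  qed
  have map: "map (orbit_walk x p) (rev (sorted_list_of_set A)) = map (orbit_walk y p) (rev (sorted_list_of_set A))"
    if p: "p permutes S" and A: "A \<subseteq> S" for p A
  proof (rule map_cong)
    fix a assume "a \<in> set (rev (sorted_list_of_set A))"
    then have "a \<in> A"
      by (cases "finite A") auto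
    with p A show "orbit_walk x p a = orbit_walk y p a"
      by (intro walk) auto
  qed simp
  show ?thesis
    unfolding det_on_def
  proof (rule sum.cong)
    fix p assume "p \<in> {p. p permutes S}"
    then have "p permutes S" by simp
    then show "of_int (sign p) * prod_list (map (orbit_walk x p)
          (rev (sorted_list_of_set {a \<in> S. \<forall>b \<in> orbit p a. b \<le> a})))
      = of_int (sign p) * prod_list (map (orbit_walk y p)
          (rev (sorted_list_of_set {a \<in> S. \<forall>b \<in> orbit p a. b \<le> a})))"
      by (simp only: map[OF _ Collect_subset])
  qed simp
qed

lemma bij_betw_pick:
  assumes "finite I"
  shows "bij_betw (pick I) {0..<card I} I"
proof -
  have "strict_mono_on {0..<card I} (pick I)"
    by (rule strict_mono_onI) (rule pick_mono, simp_all)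
  then have inj: "inj_on (pick I) {0..<card I}"
    by (rule strict_mono_on_imp_inj_on)
  have "pick I ` {0..<card I} = I"
  proof (rule card_subset_eq[OF assms])
    show "pick I ` {0..<card I} \<subseteq> I"
      by (rule image_subsetI) (rule pick_in_set, simp)
    show "card (pick I ` {0..<card I}) = card I"
      unfolding card_image[OF inj] by simp
  qed
  with inj show ?thesis
    by (rule bij_betw_imageI)
qed

text \<open>Any enumeration \<open>e\<close> of the rows will do, since the Gram sum ignores their
  order: the identity serves for \<open>C\<close> itself and \<open>pick I\<close> for its
  submatrices.\<close>

lemma Det_M_dual_mult:
  assumes D: "D \<in> carrier_mat k m" and e: "bij_betw e {0..<k} J"
    and entries: "\<And>i j. i < k \<Longrightarrow> j < m \<Longrightarrow> D $$ (i, j) = w (e i) j"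
  shows "Det_M (dual_mat D * D) = det_on (gram w J) {0..<m}"
proof -
  have entry: "(dual_mat D * D) $$ (a, b) = gram w J a b" if "a < m" "b < m" for a b
  proof -
    have "(dual_mat D * D) $$ (a, b) = (\<Sum>i \<in> {0..<k}. cq_conj (w (e i) a) * w (e i) b)"
      using D that by (simp add: dual_mat_def scalar_prod_def entries)
    also have "\<dots> = gram w J a b"
      unfolding gram_def by (rule sum.reindex_bij_betw[OF e])
    finally show ?thesis .
  qed
  have dim: "dim_row (dual_mat D * D) = m"
    using D by (simp add: dual_mat_def)
  show ?thesis
    unfolding Det_M_eq_det_on dim by (rule det_on_cong) (simp add: entry)
qed

theorem theorem2p1:
  fixes C :: "cquat mat" and n m :: nat
  assumes "C \<in> carrier_mat n m" and "n \<ge> m"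
  shows "Det_M (dual_mat C * C) =
    (\<Sum>I | I \<subseteq> {0..<n} \<and> card I = m.
       Det_M (dual_mat (submatrix C I UNIV) * submatrix C I UNIV))"
proof -
  define w where "w i j = C $$ (i, j)" for i j
  define g where "g J = det_on (gram w J) {0..<m}" for J
  \<comment> \<open>Each Gram entry is additive in the set of rows, so the determinant on
    \<open>m\<close> indices has degree at most \<open>m\<close>.\<close>
  have "set_degree_le 1 (\<lambda>J. gram w J a b)" for a b
    unfolding gram_def by (rule set_degree_le_linear)
  from set_degree_le_det_on[of "gram w", OF this, of "{0..<m}"] have "set_degree_le m g"
    by (simp add: g_def[abs_def])
  then have g: "g {0..<n} = (\<Sum>I | I \<subseteq> {0..<n} \<and> card I = m. g I)"
    by (rule set_degree_le_eq_sum) (auto simp: g_def intro: det_on_gram_eq_zero)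
  have "Det_M (dual_mat C * C) = g {0..<n}"
    unfolding g_def by (rule Det_M_dual_mult[OF assms(1) bij_betw_id]) (simp add: w_def)
  moreover have "Det_M (dual_mat (submatrix C I UNIV) * submatrix C I UNIV) = g I"
    if I: "I \<subseteq> {0..<n}" "card I = m" for I
    unfolding g_def
  proof (rule Det_M_dual_mult)
    have rows: "{i. i < dim_row C \<and> i \<in> I} = I"
      using assms(1) I(1) by auto
    show "submatrix C I UNIV \<in> carrier_mat (card I) m"
      using assms(1) rows by (auto simp: submatrix_def)
    show "bij_betw (pick I) {0..<card I} I"
      using I(1) by (intro bij_betw_pick) (rule finite_subset, auto)
    show "submatrix C I UNIV $$ (i, j) = w (pick I i) j" if "i < card I" "j < m" for i j
      using assms(1) rows that by (simp add: submatrix_def w_def pick_UNIV)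
  qed
  ultimately show ?thesis
    unfolding g by (auto intro!: sum.cong)
qed

end
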